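(* Let $0<\beta<1$ and let $\rho\in C(0,+\infty)\cap L^{1}_{Loc}[0,+\infty)$. If $\lim_{t\to+\infty}t^{\beta}\rho(t)=0$, then $$\lim_{t\to+\infty}\int_{0}^{t}(t-s)^{\beta-1}\rho(s)\,ds=0.$$
   Context: $C(0,+\infty)$ is the set of continuous real-valued functions on $(0,+\infty)$. $L^{1}_{Loc}[0,+\infty)$ is the space of all real-valued functions $f$ such that $|f|$ is Lebesgue integrable over every bounded subinterval of $[0,+\infty)$ (in particular near $0$). *)

theory Defs
  imports "HOL-Analysis.Analysis"
begin

(* As usual for L^1, measurability of f is included (via set_integrable), in addition to
   integrability of |f|. The value f 0 lies on a null set and hence is immaterial. *)
definition L1_loc :: "(real \<Rightarrow> real) set" where
  "L1_loc = {f. \<forall>S. is_interval S \<and> bounded S \<and> S \<subseteq> {0..} \<longrightarrow> set_integrable lebesgue S f}"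

end

theory Submission
  imports Defs
begin

text \<open>
  The kernel \<open>(t - s) powr (\<beta> - 1)\<close> is homogeneous of degree \<open>\<beta> - 1\<close>, so it turns the comparison
  function \<open>s powr - \<beta>\<close> into a function of degree \<open>0\<close>: the convolution of the two
  over \<open>{0..t}\<close> is the constant \<open>Beta (1 - \<beta>) \<beta>\<close> (lemma \<open>has_integral_Beta_convolution\<close>).  By hypothesis
  \<open>\<bar>\<rho> s\<bar> \<le> \<epsilon> * s powr - \<beta>\<close> beyond some \<open>T\<close>, so that the part of the integral over \<open>{T..t}\<close> is at
  most \<open>\<epsilon> * Beta (1 - \<beta>) \<beta>\<close>, uniformly in \<open>t\<close>.  On the fixed interval \<open>{0..T}\<close>, where
  \<open>\<rho>\<close> may be unbounded but is integrable, the kernel is at most \<open>(t - T) powr (\<beta> - 1)\<close>, and this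
  tends to \<open>0\<close> because \<open>\<beta> < 1\<close>.  Lemma \<open>weakly_singular_convolution_bound\<close> adds up the two estimates.
\<close>

text \<open>The substitution \<open>s = t * u\<close> reduces this to Euler's integral over \<open>{0..1}\<close>; the powers of \<open>t\<close>
  that it produces cancel, since the two exponents add up to \<open>-1\<close>.\<close>

lemma has_integral_Beta_convolution:
  fixes \<beta> t :: real
  assumes "0 < \<beta>" "\<beta> < 1" "0 < t"
  shows "((\<lambda>s. (t - s) powr (\<beta> - 1) * s powr - \<beta>) has_integral Beta (1 - \<beta>) \<beta>) {0..t}"
proof -
  let ?e = "\<lambda>u::real. u powr - \<beta> * (1 - u) powr (\<beta> - 1)"
  have "(?e has_integral Beta (1 - \<beta>) \<beta>) {0..1}"
    using has_integral_Beta_real[of "1 - \<beta>" \<beta>] assms by simp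
  then have "((\<lambda>s. ?e (inverse t * s)) has_integral t * Beta (1 - \<beta>) \<beta>) {0..t}"
    using has_integral_affinity[of ?e "Beta (1 - \<beta>) \<beta>" 0 1 "inverse t" 0] assms
    by (simp add: inverse_eq_divide)
  then have scaled: "((\<lambda>s. inverse t * ?e (inverse t * s)) has_integral Beta (1 - \<beta>) \<beta>) {0..t}"
    using assms by (intro has_integral_eq_rhs[OF has_integral_mult_right]) auto
  have "inverse t * ?e (inverse t * s) = (t - s) powr (\<beta> - 1) * s powr - \<beta>" if "s \<in> {0..t}" for s
  proof -
    have "1 - inverse t * s = (t - s) / t" "inverse t * s = s / t"
      using assms by (simp_all add: field_simps)
    then have "inverse t * ?e (inverse t * s)
        = (t - s) powr (\<beta> - 1) * s powr - \<beta> / (t * (t powr - \<beta> * t powr (\<beta> - 1)))"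
      using that assms by (simp add: powr_divide field_simps)
    also have "t powr - \<beta> * t powr (\<beta> - 1) = inverse t"
      using assms by (simp add: powr_add[symmetric] powr_neg_one inverse_eq_divide)
    finally show ?thesis
      using assms by simp
  qed
  then show ?thesis
    by (rule has_integral_eq[OF _ scaled])
qed

lemma
  fixes \<beta> t :: real
  assumes "0 < \<beta>" "\<beta> < 1" "0 < t"
  shows set_integrable_Beta_convolution:
      "set_integrable lebesgue {0..t} (\<lambda>s. (t - s) powr (\<beta> - 1) * s powr - \<beta>)" (is ?int)
    and set_lebesgue_integral_Beta_convolution:
      "(LINT s:{0..t}|lebesgue. (t - s) powr (\<beta> - 1) * s powr - \<beta>) = Beta (1 - \<beta>) \<beta>" (is ?val)
proof -
  note Beta = has_integral_Beta_convolution[OF assms]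
  show ?int
    using Beta by (intro nonnegative_absolutely_integrable_1) (auto simp: integrable_on_def)
  then show ?val
    using Beta by (simp add: set_lebesgue_integral_eq_integral(2) integral_unique)
qed

text \<open>The right-hand side is the integral of an explicit majorant: below \<open>T\<close> the kernel is replaced
  by its value at \<open>T\<close>, beyond \<open>T\<close> the function \<open>\<rho>\<close> is replaced by \<open>c * s powr - \<beta>\<close>.
  The second part is extended from \<open>{T..t}\<close> to all of \<open>{0..t}\<close>, where its integral is known exactly.\<close>

lemma weakly_singular_convolution_bound:
  fixes \<beta> c T t :: real and \<rho> :: "real \<Rightarrow> real"
  assumes \<beta>: "0 < \<beta>" "\<beta> < 1" and T: "0 \<le> T" "T < t" and "0 \<le> c"
    and int: "set_integrable lebesgue {0..T} \<rho>"
    and decay: "\<And>s. T < s \<Longrightarrow> \<bar>\<rho> s\<bar> \<le> c * s powr - \<beta>"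
  shows "\<bar>LINT s:{0..t}|lebesgue. (t - s) powr (\<beta> - 1) * \<rho> s\<bar>
    \<le> (t - T) powr (\<beta> - 1) * (LINT s:{0..T}|lebesgue. \<bar>\<rho> s\<bar>) + c * Beta (1 - \<beta>) \<beta>"
proof -
  define f where "f s = indicator {0..t} s * ((t - s) powr (\<beta> - 1) * \<rho> s)" for s
  define g where "g s = (t - T) powr (\<beta> - 1) * (indicator {0..T} s * \<bar>\<rho> s\<bar>)
    + c * (indicator {0..t} s * ((t - s) powr (\<beta> - 1) * s powr - \<beta>))" for s
  have "0 < t"
    using T by simp
  have near: "integrable lebesgue (\<lambda>s. indicator {0..T} s * \<bar>\<rho> s\<bar>)"
    using set_integrable_abs[OF int] by (simp add: set_integrable_def)
  have far: "integrable lebesgue (\<lambda>s. indicator {0..t} s * ((t - s) powr (\<beta> - 1) * s powr - \<beta>))"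
    using set_integrable_Beta_convolution[OF \<beta> \<open>0 < t\<close>] by (simp add: set_integrable_def)
  have g_int: "integrable lebesgue g"
    unfolding g_def by (intro Bochner_Integration.integrable_add integrable_mult_right near far)
  have g_val: "integral\<^sup>L lebesgue g
      = (t - T) powr (\<beta> - 1) * (LINT s:{0..T}|lebesgue. \<bar>\<rho> s\<bar>) + c * Beta (1 - \<beta>) \<beta>"
    using set_lebesgue_integral_Beta_convolution[OF \<beta> \<open>0 < t\<close>] near far
    by (simp add: g_def[abs_def] set_lebesgue_integral_def)
  have g_nonneg: "0 \<le> g s" for s
    using \<open>0 \<le> c\<close> by (simp add: g_def)
  have dominated: "\<bar>f s\<bar> \<le> g s" for s
  proof (cases "s \<in> {0..t}")
    case False
    then show ?thesis
      using g_nonneg[of s] by (simp add: f_def)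
  next
    case s: True
    show ?thesis
    proof (cases "s \<le> T")
      case True
      have "(t - s) powr (\<beta> - 1) * \<bar>\<rho> s\<bar> \<le> (t - T) powr (\<beta> - 1) * \<bar>\<rho> s\<bar>"
        using True \<beta> T by (intro mult_right_mono powr_mono2') auto
      moreover have "0 \<le> c * ((t - s) powr (\<beta> - 1) * s powr - \<beta>)"
        using \<open>0 \<le> c\<close> by simp
      ultimately show ?thesis
        using s True by (simp add: f_def g_def abs_mult)
    next
      case False
      then have "(t - s) powr (\<beta> - 1) * \<bar>\<rho> s\<bar> \<le> (t - s) powr (\<beta> - 1) * (c * s powr - \<beta>)"
        by (intro mult_left_mono decay) auto
      then show ?thesis
        using s False by (simp add: f_def g_def abs_mult mult_ac)
    qed
  qed
  have "\<bar>integral\<^sup>L lebesgue f\<bar> \<le> integral\<^sup>L lebesgue g"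
  proof (cases "integrable lebesgue f")
    case True
    then show ?thesis
      using True g_int dominated by (intro integral_abs_bound_integral)
  next
    \<comment> \<open>Here the integral on the left is \<open>0\<close> by convention, and \<open>g\<close> is nonnegative.\<close>
    case False
    then show ?thesis
      using g_nonneg by (simp add: not_integrable_integral_eq)
  qed
  then show ?thesis
    by (simp add: g_val f_def[abs_def] set_lebesgue_integral_def)
qed

theorem lemma2p7:
  fixes \<beta> :: real and \<rho> :: "real \<Rightarrow> real"
  assumes "0 < \<beta>" and "\<beta> < 1"
    and "continuous_on {0<..} \<rho>" and "\<rho> \<in> L1_loc"
    and "((\<lambda>t. t powr \<beta> * \<rho> t) \<longlongrightarrow> 0) at_top"
  shows "((\<lambda>t. LINT s:{0..t}|lebesgue. (t - s) powr (\<beta> - 1) * \<rho> s) \<longlongrightarrow> 0) at_top"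
proof (rule tendstoI)
  fix e :: real
  assume "0 < e"
  define B where "B = Beta (1 - \<beta>) \<beta>"
  have "0 \<le> B"
    unfolding B_def
    by (rule has_integral_nonneg[OF has_integral_Beta_convolution[OF assms(1,2) zero_less_one]]) auto
  \<comment> \<open>The denominator \<open>B + 1\<close> instead of \<open>B\<close> makes the share of the tail strictly less than \<open>e / 2\<close>.\<close>
  define c where "c = e / (2 * (B + 1))"
  have c: "0 < c" "c * B < e / 2"
    using \<open>0 < e\<close> \<open>0 \<le> B\<close> by (simp_all add: c_def divide_simps)
  have "\<forall>\<^sub>F s in at_top. \<bar>s powr \<beta> * \<rho> s\<bar> < c"
    using tendstoD[OF assms(5) c(1)] by (simp add: dist_real_def)
  then obtain T\<^sub>0 where T\<^sub>0: "\<And>s. T\<^sub>0 \<le> s \<Longrightarrow> \<bar>s powr \<beta> * \<rho> s\<bar> < c"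
    unfolding eventually_at_top_linorder by blast
  define T where "T = max 0 T\<^sub>0"
  have "0 \<le> T"
    by (simp add: T_def)
  have decay: "\<bar>\<rho> s\<bar> \<le> c * s powr - \<beta>" if "T < s" for s
  proof -
    have "s powr \<beta> * \<bar>\<rho> s\<bar> \<le> c"
      using T\<^sub>0[of s] that by (simp add: T_def abs_mult)
    then have "\<bar>\<rho> s\<bar> \<le> c / s powr \<beta>"
      using that by (subst pos_le_divide_eq) (auto simp: T_def mult.commute)
    then show ?thesis
      by (simp add: powr_minus_divide)
  qed
  have int: "set_integrable lebesgue {0..T} \<rho>"
    using assms(4) by (simp add: L1_loc_def is_interval_cc)
  define A where "A = (LINT s:{0..T}|lebesgue. \<bar>\<rho> s\<bar>)"
  have "((\<lambda>t. (t - T) powr (\<beta> - 1)) \<longlongrightarrow> 0) at_top"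
    using tendsto_neg_powr[OF _ filterlim_tendsto_add_at_top[OF tendsto_const[of "- T"] filterlim_ident]]
      assms(2)
    by simp
  then have "((\<lambda>t. (t - T) powr (\<beta> - 1) * A) \<longlongrightarrow> 0) at_top"
    by (rule tendsto_mult_left_zero)
  then have "\<forall>\<^sub>F t in at_top. (t - T) powr (\<beta> - 1) * A < e / 2"
    by (rule order_tendstoD(2)) (use \<open>0 < e\<close> in simp)
  then show "\<forall>\<^sub>F t in at_top.
      dist (LINT s:{0..t}|lebesgue. (t - s) powr (\<beta> - 1) * \<rho> s) 0 < e"
    using eventually_gt_at_top[of T]
  proof eventually_elim
    case (elim t)
    have "\<bar>LINT s:{0..t}|lebesgue. (t - s) powr (\<beta> - 1) * \<rho> s\<bar>
        \<le> (t - T) powr (\<beta> - 1) * A + c * B"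
      unfolding A_def B_def
      using assms(1,2) \<open>0 \<le> T\<close> elim(2) less_imp_le[OF c(1)] int decay
      by (rule weakly_singular_convolution_bound)
    then show ?case
      using elim(1) c(2) by simp
  qed
qed

end
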